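(* Let $X,Y$ be Banach spaces. ($\alpha$) If $L:X\to Y$ is linear bounded and $M:Y\rightrightarrows Y^*$ is maximal monotone with $\operatorname{Graph}(M)$ convex in $Y\times Y^*$ and $0\in{}^{\rm ic}(R(L)-D(M))$, then $T:=L^*ML:X\rightrightarrows X^*$ is maximal monotone. ($\beta$) If $A,B:X\rightrightarrows X^*$ are maximal monotone operators in $X$ with $\operatorname{Graph}(A)$, $\operatorname{Graph}(B)$ convex and $0\in{}^{\rm ic}(D(A)-D(B))$, then $A+B$ is maximal monotone.
   Context: All Banach spaces are real and possibly non-reflexive, with duals $X^*$, $Y^*$. For a multi-valued operator $A:X\rightrightarrows X^*$, $D(A)=\{x:Ax\neq\emptyset\}$ and $\operatorname{Graph}(A)=\{(x,x^* ):x^*\in Ax\}$. $A$ is monotone if $\langle x_1-x_2,x_1^*-x_2^*\rangle\ge0$ whenever $x_i^*\in Ax_i$ ($i=1,2$), and maximal monotone if its graph is maximal under inclusion among monotone subsets of $X\times X^*$. The sum is $(A+B)(x)=\{a^*+b^*:a^*\in Ax,\ b^*\in Bx\}$. $L^*:Y^*\to X^*$ is the adjoint of $L$, $R(L)$ its range, and $(L^*ML)(x)=\{L^*y^*:y^*\in M(Lx)\}$. For a subset $S$ of a Banach space, ${}^iS$ denotes its relative algebraic interior, i.e. the algebraic interior (core) of $S$ relative to its affine hull; ${}^{\rm ic}S={}^iS$ if the affine hull of $S$ is closed, and ${}^{\rm ic}S=\emptyset$ otherwise. *)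

theory Defs
  imports "HOL-Analysis.Analysis"
begin

text \<open>
  The dual of \<open>X\<close> is the type \<open>'x \<Rightarrow>\<^sub>L real\<close> of bounded linear functionals, and a multi-valued
  operator from \<open>X\<close> to its dual is a function of type \<open>'x \<Rightarrow> ('x \<Rightarrow>\<^sub>L real) set\<close>.
\<close>

definition op_domain :: "('a \<Rightarrow> 'b set) \<Rightarrow> 'a set"
  where "op_domain A = {x. A x \<noteq> {}}"

definition op_graph :: "('a \<Rightarrow> 'b set) \<Rightarrow> ('a \<times> 'b) set"
  where "op_graph A = {(x, x'). x' \<in> A x}"

definition monotone_set :: "('x::real_normed_vector \<times> ('x \<Rightarrow>\<^sub>L real)) set \<Rightarrow> bool"
  where "monotone_set G \<longleftrightarrow>
    (\<forall>(x1, f1) \<in> G. \<forall>(x2, f2) \<in> G. 0 \<le> blinfun_apply (f1 - f2) (x1 - x2))"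

definition monotone_op :: "('x::real_normed_vector \<Rightarrow> ('x \<Rightarrow>\<^sub>L real) set) \<Rightarrow> bool"
  where "monotone_op A \<longleftrightarrow> monotone_set (op_graph A)"

definition maximal_monotone_op :: "('x::real_normed_vector \<Rightarrow> ('x \<Rightarrow>\<^sub>L real) set) \<Rightarrow> bool"
  where "maximal_monotone_op A \<longleftrightarrow>
    monotone_op A \<and> (\<forall>G. monotone_set G \<and> op_graph A \<subseteq> G \<longrightarrow> G = op_graph A)"

definition op_sum :: "('a \<Rightarrow> 'b::plus set) \<Rightarrow> ('a \<Rightarrow> 'b set) \<Rightarrow> 'a \<Rightarrow> 'b set"
  where "op_sum A B x = {a + b |a b. a \<in> A x \<and> b \<in> B x}"

text \<open>The Banach-space adjoint; the library's \<open>adjoint\<close> is the one for inner product spaces.\<close>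

definition dual_adjoint ::
    "('x::real_normed_vector \<Rightarrow>\<^sub>L 'y::real_normed_vector) \<Rightarrow> ('y \<Rightarrow>\<^sub>L real) \<Rightarrow> ('x \<Rightarrow>\<^sub>L real)"
  where "dual_adjoint L g = g o\<^sub>L L"

definition op_pullback ::
    "('x::real_normed_vector \<Rightarrow>\<^sub>L 'y::real_normed_vector) \<Rightarrow> ('y \<Rightarrow> ('y \<Rightarrow>\<^sub>L real) set)
      \<Rightarrow> 'x \<Rightarrow> ('x \<Rightarrow>\<^sub>L real) set"
  where "op_pullback L M x = {dual_adjoint L g |g. g \<in> M (blinfun_apply L x)}"

text \<open>The algebraic difference of two sets; the infix minus sign on sets is the set-theoretic
  difference.\<close>

definition algebraic_diff :: "'a::minus set \<Rightarrow> 'a set \<Rightarrow> 'a set"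
  where "algebraic_diff S T = {s - t |s t. s \<in> S \<and> t \<in> T}"

text \<open>
  \<open>rel_core S\<close> is \<open>\<^sup>iS\<close>: from a point \<open>a\<close> one can move some positive distance in \<open>S\<close> towards every
  point of the affine hull. The conjunct \<open>a \<in> S\<close> follows from the second one unless \<open>S\<close> is empty.
\<close>

definition rel_core :: "'a::real_vector set \<Rightarrow> 'a set"
  where "rel_core S =
    {a \<in> S. \<forall>x \<in> affine hull S. \<exists>\<delta>>0. \<forall>t\<in>{0..\<delta>}. a + t *\<^sub>R (x - a) \<in> S}"

text \<open>\<open>ic_core S\<close> is \<open>\<^sup>i\<^sup>cS\<close>.\<close>

definition ic_core :: "'a::real_normed_vector set \<Rightarrow> 'a set"
  where "ic_core S = (if closed (affine hull S) then rel_core S else {})"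

end

theory Submission
  imports Defs
begin

text \<open>
  Both parts are special cases of the maximality of \<open>A + L\<^sup>*ML\<close>: take \<open>A = 0\<close> for the first and
  \<open>L = id\<close> for the second. A convex maximal monotone graph is automatically affine, so
  \<open>L D(A) - D(M)\<close> is affine and the interiority condition just says that it is a closed subspace
  of \<open>Y\<close>. Let \<open>(x\<^sub>0, f\<^sub>0)\<close> be monotonically related to the graph of
  \<open>A + L\<^sup>*ML\<close>. For \<open>(a, f)\<close> in the graph of \<open>A\<close> and \<open>(b, h)\<close> in that of \<open>M\<close>,
  the convex quadratic functional \<open>f\<^sub>0 (x\<^sub>0 - a) - f (x\<^sub>0 - a) - h (L x\<^sub>0 - b)\<close> is then nonnegative
  wherever \<open>L a = b\<close>. A Lagrange multiplier \<open>g\<close> in the dual of \<open>Y\<close> for this constraint, which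
  exists by the open mapping and Hahn-Banach theorems, splits the inequality into one for \<open>A\<close> and
  one for \<open>M\<close>, and maximality gives \<open>f\<^sub>0 + L\<^sup>*g \<in> A x\<^sub>0\<close> and \<open>-g \<in> M (L x\<^sub>0)\<close>.
\<close>

subsection \<open>Sublinear functionals\<close>

text \<open>The scaling inequality for positive \<open>t\<close> suffices: applied to
  \<open>1 / t\<close> it gives equality, and \<open>p 0 = 0\<close> follows. This shortens the
  check for infima.\<close>

definition sublinear :: "('a::real_vector \<Rightarrow> real) \<Rightarrow> bool"
  where "sublinear p \<longleftrightarrow>
    (\<forall>x y. p (x + y) \<le> p x + p y) \<and> (\<forall>t x. 0 < t \<longrightarrow> p (t *\<^sub>R x) \<le> t * p x)"

lemma sublinear_add: "sublinear p \<Longrightarrow> p (x + y) \<le> p x + p y"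
  by (simp add: sublinear_def)

lemma sublinear_scale_le: "sublinear p \<Longrightarrow> 0 < t \<Longrightarrow> p (t *\<^sub>R x) \<le> t * p x"
  by (simp add: sublinear_def)

lemma sublinear_0:
  assumes "sublinear p" shows "p 0 = 0"
  using sublinear_add[OF assms, of 0 0] sublinear_scale_le[OF assms, of "1/2" 0] by simp

lemma sublinear_minus: "sublinear p \<Longrightarrow> - p (- x) \<le> p x"
  using sublinear_add[of p x "- x"] sublinear_0[of p] by simp

lemma sublinear_scale:
  assumes p: "sublinear p" and t: "0 \<le> t" shows "p (t *\<^sub>R x) = t * p x"
proof (cases "t = 0")
  case True
  then show ?thesis using sublinear_0[OF p] by simp
next
  case False
  with t have t: "0 < t" by simp
  have "p x \<le> (1 / t) * p (t *\<^sub>R x)"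
    using sublinear_scale_le[OF p, of "1 / t" "t *\<^sub>R x"] t by simp
  then have "t * p x \<le> p (t *\<^sub>R x)" using t by (simp add: field_simps)
  with sublinear_scale_le[OF p t, of x] show ?thesis by linarith
qed

text \<open>Minimality is used against the sublinear functional
  \<open>x \<mapsto> inf\<^sub>t\<^sub>\<ge>\<^sub>0 (q (x + t y) - t q y)\<close>, whose value at \<open>t = 1\<close> gives superadditivity.\<close>

lemma minimal_sublinear_linear:
  assumes q: "sublinear q"
    and min: "\<And>r. sublinear r \<Longrightarrow> (\<And>x. r x \<le> q x) \<Longrightarrow> r = q"
  shows "linear q"
proof -
  have super: "q x + q y \<le> q (x + y)" for x y
  proof -
    define S where "S x = (\<lambda>t. q (x + t *\<^sub>R y) - t * q y) ` {0..}" for x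
    define r where "r x = Inf (S x)" for x
    \<comment> \<open>The bound does not depend on \<open>t\<close>, so the infimum
      \<open>r x\<close> is finite.\<close>
    have low: "- q (- x) \<le> q (x + t *\<^sub>R y) - t * q y" if "0 \<le> t" for x t
      using sublinear_add[OF q, of "x + t *\<^sub>R y" "- x"] sublinear_scale[OF q that, of y] by simp
    have bdd: "bdd_below (S x)" for x
      unfolding S_def using low by (intro bdd_belowI2[where m = "- q (- x)"]) auto
    have ne: "S x \<noteq> {}" for x by (auto simp: S_def)
    have rle: "r x \<le> q (x + t *\<^sub>R y) - t * q y" if "0 \<le> t" for x t
      unfolding r_def by (rule cInf_lower[OF _ bdd]) (use that in \<open>auto simp: S_def\<close>)
    have rge: "c \<le> r x" if "\<And>t. 0 \<le> t \<Longrightarrow> c \<le> q (x + t *\<^sub>R y) - t * q y" for c x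
      unfolding r_def by (rule cInf_greatest[OF ne]) (use that in \<open>auto simp: S_def\<close>)
    have "r = q"
    proof (rule min)
      show "r x \<le> q x" for x using rle[of 0 x] by simp
      show "sublinear r"
        unfolding sublinear_def
      proof (intro conjI allI impI)
        fix x z
        \<comment> \<open>The parameters \<open>s\<close> and \<open>t\<close> add up on the left,
          so the two infima on the right can be taken one after the other.\<close>
        have 1: "r (x + z) \<le> (q (x + s *\<^sub>R y) - s * q y) + (q (z + t *\<^sub>R y) - t * q y)"
          if "0 \<le> s" "0 \<le> t" for s t
          using rle[of "s + t" "x + z"] that
            sublinear_add[OF q, of "x + s *\<^sub>R y" "z + t *\<^sub>R y"]
          by (simp add: algebra_simps)
        have "r (x + z) - (q (x + s *\<^sub>R y) - s * q y) \<le> r z" if "0 \<le> s" for s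
          using 1[OF that] by (intro rge) (simp add: algebra_simps)
        then have "r (x + z) - r z \<le> r x"
          by (intro rge) (simp add: algebra_simps)
        then show "r (x + z) \<le> r x + r z" by simp
      next
        fix c :: real and x assume c: "0 < c"
        have "r (c *\<^sub>R x) / c \<le> q (x + t *\<^sub>R y) - t * q y" if "0 \<le> t" for t
          using rle[of "c * t" "c *\<^sub>R x"] that c sublinear_scale[OF q, of c "x + t *\<^sub>R y"]
          by (simp add: field_simps)
        then have "r (c *\<^sub>R x) / c \<le> r x" by (intro rge)
        then show "r (c *\<^sub>R x) \<le> c * r x" using c by (simp add: field_simps)
      qed
    qed
    then show ?thesis using rle[of 1 x] by simp
  qed
  have add: "q (x + y) = q x + q y" for x y
    using super[of x y] sublinear_add[OF q, of x y] by linarith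
  have neg: "q (- x) = - q x" for x
    using add[of x "- x"] sublinear_0[OF q] by simp
  show ?thesis
  proof (rule linearI)
    show "q (t *\<^sub>R x) = t *\<^sub>R q x" for t x
      using sublinear_scale[OF q, of t x] sublinear_scale[OF q, of "- t" x] neg[of "t *\<^sub>R x"]
      by (cases "0 \<le> t") auto
  qed (rule add)
qed

text \<open>The pointwise infimum of a nonempty chain of sublinear functionals below
  \<open>p\<close> is again one, so Zorn's lemma yields a minimal one, which is linear.\<close>

theorem hahn_banach_sublinear:
  assumes p: "sublinear p"
  obtains g where "linear g" "\<And>x. g x \<le> p x"
proof -
  define A where "A = {q. sublinear q \<and> (\<forall>x. q x \<le> p x)}"
  have "\<exists>m\<in>A. \<forall>a\<in>A. a \<le> m \<longrightarrow> a = m"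
  proof (rule predicate_Zorn)
    \<comment> \<open>The order is reversed, so that a maximal element is a minimal
      functional.\<close>
    show "partial_order_on A (relation_of (\<lambda>a b. b \<le> a) A)"
      by (rule partial_order_on_relation_ofI) auto
    fix C assume "C \<in> Chains (relation_of (\<lambda>a b. b \<le> a) A)"
    then have CA: "C \<subseteq> A" and tot: "\<And>a b. a \<in> C \<Longrightarrow> b \<in> C \<Longrightarrow> a \<le> b \<or> b \<le> a"
      unfolding Chains_def relation_of_def by blast+
    show "\<exists>u\<in>A. \<forall>a\<in>C. u \<le> a"
    proof (cases "C = {}")
      case True
      then show ?thesis using p by (auto simp: A_def)
    next
      case ne: False
      have sub: "sublinear a" "a x \<le> p x" if "a \<in> C" for a x
        using that CA by (auto simp: A_def)
      define u where "u x = (INF a\<in>C. a x)" for x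
      have "- p (- x) \<le> a x" if "a \<in> C" for a x
        using sub(1)[OF that] sub(2)[OF that, of "- x"] sublinear_minus[of a x] by linarith
      then have bdd: "bdd_below ((\<lambda>a. a x) ` C)" for x
        by (intro bdd_belowI2)
      have ule: "u x \<le> a x" if "a \<in> C" for a x
        unfolding u_def by (rule cINF_lower[OF bdd that])
      have uge: "c \<le> u x" if "\<And>a. a \<in> C \<Longrightarrow> c \<le> a x" for c x
        unfolding u_def by (rule cINF_greatest[OF ne]) (use that in auto)
      have "sublinear u"
        unfolding sublinear_def
      proof (intro conjI allI impI)
        fix x y
        have 1: "u (x + y) \<le> a x + b y" if ab: "a \<in> C" "b \<in> C" for a b
        proof -
          \<comment> \<open>In a chain, the smaller of \<open>a\<close> and \<open>b\<close> serves
            for both summands.\<close>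
          obtain c where "c \<in> C" "c \<le> a" "c \<le> b" using tot ab by blast
          then show ?thesis
            using ule[of c "x + y"] sublinear_add[OF sub(1)[OF \<open>c \<in> C\<close>], of x y]
            by (smt (verit) le_fun_def)
        qed
        have "u (x + y) - a x \<le> u y" if "a \<in> C" for a
          using 1[OF that] by (intro uge) (simp add: algebra_simps)
        then have "u (x + y) - u y \<le> u x"
          by (intro uge) (simp add: algebra_simps)
        then show "u (x + y) \<le> u x + u y" by simp
      next
        fix t :: real and x assume t: "0 < t"
        have "u (t *\<^sub>R x) / t \<le> a x" if "a \<in> C" for a
          using ule[OF that, of "t *\<^sub>R x"] sublinear_scale_le[OF sub(1)[OF that] t, of x] t
          by (simp add: field_simps)
        then have "u (t *\<^sub>R x) / t \<le> u x" by (rule uge)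
        then show "u (t *\<^sub>R x) \<le> t * u x" using t by (simp add: field_simps)
      qed
      moreover have "u x \<le> p x" for x
        using ne ule sub(2) by (meson all_not_in_conv order_trans)
      ultimately show ?thesis
        using ule by (auto simp: A_def le_fun_def)
    qed
  qed
  then obtain m where m: "m \<in> A" and min: "\<And>a. a \<in> A \<Longrightarrow> a \<le> m \<Longrightarrow> a = m" by blast
  have "linear m"
  proof (rule minimal_sublinear_linear)
    show "sublinear m" using m by (simp add: A_def)
    show "r = m" if "sublinear r" "\<And>x. r x \<le> m x" for r
      using min[of r] that m by (force simp: A_def le_fun_def intro: order_trans)
  qed
  then show thesis using that m by (auto simp: A_def)
qed

subsection \<open>Bounded preimages\<close>

text \<open>First half of the open mapping theorem. The closed image of \<open>W\<close> is complete
  and covered by the closures of the images of balls of \<open>W\<close>. By Baire one closure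
  contains a relative ball; differences of its points, rescaled, give the approximation.\<close>

lemma linear_image_approx_preimage:
  fixes K :: "'e::real_normed_vector \<Rightarrow> 'y::banach"
  assumes K: "linear K" and W: "subspace W" and cl: "closed (K ` W)"
  obtains C where "0 \<le> C"
    "\<And>u. u \<in> K ` W \<Longrightarrow> \<exists>w\<in>W. norm w \<le> C * norm u \<and> norm (u - K w) \<le> norm u / 2"
proof -
  interpret K: linear K by fact
  let ?Z = "K ` W" and ?X = "top_of_set (K ` W)"
  let ?F = "\<lambda>n::nat. ?Z \<inter> closure (K ` (W \<inter> cball 0 n))"
  have subZ: "subspace ?Z" by (rule linear_subspace_image[OF K W])
  have "\<exists>n. ?X interior_of (?F n) \<noteq> {}"
  proof (rule ccontr)
    assume "\<not> ?thesis"
    then have "?X interior_of (\<Union> (range ?F)) = {}"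
      using cl by (intro Baire_category_alt)
        (auto intro: completely_metrizable_space_closedin completely_metrizable_space_euclidean
          simp: closedin_closed_Int)
    moreover have "\<Union> (range ?F) = ?Z"
    proof
      show "?Z \<subseteq> \<Union> (range ?F)"
      proof
        fix z assume "z \<in> ?Z"
        then obtain w where w: "w \<in> W" "z = K w" by blast
        obtain n :: nat where "norm w \<le> n" using real_arch_simple by blast
        with w have "z \<in> ?F n" using closure_subset by fastforce
        then show "z \<in> \<Union> (range ?F)" by blast
      qed
    qed auto
    ultimately have "?Z = {}"
      by (metis interior_of_topspace topspace_euclidean_subtopology)
    then show False using subspace_0[OF W] by blast
  qed
  then obtain n z0 where "z0 \<in> ?X interior_of (?F n)" by blast
  then obtain T where T: "openin ?X T" "z0 \<in> T" "T \<subseteq> ?F n"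
    by (auto simp: interior_of_def)
  then obtain r where r: "0 < r" "ball z0 r \<inter> ?Z \<subseteq> T" and z0: "z0 \<in> ?Z"
    using openin_contains_ball[of ?Z T] by blast
  \<comment> \<open>Two errors of \<open>r / 8\<close> make \<open>r / 4\<close>, half the norm of
    the rescaled vector of norm \<open>r / 2\<close> used below.\<close>
  have near: "\<exists>w\<in>W. norm w \<le> n \<and> norm (z - K w) < r / 8" if "z \<in> ball z0 r" "z \<in> ?Z" for z
  proof -
    have "z \<in> closure (K ` (W \<inter> cball 0 n))" using that r T by blast
    moreover have "0 < r / 8" using r by simp
    ultimately obtain w where "w \<in> W \<inter> cball 0 n" "dist (K w) z < r / 8"
      unfolding closure_approachable by blast
    then show ?thesis
      by (intro bexI[of _ w]) (auto simp: dist_norm norm_minus_commute)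
  qed
  show thesis
  proof (rule that)
    show "0 \<le> 4 * real n / r" using r by simp
    fix u assume u: "u \<in> ?Z"
    show "\<exists>w\<in>W. norm w \<le> 4 * real n / r * norm u \<and> norm (u - K w) \<le> norm u / 2"
    proof (cases "u = 0")
      case True
      then show ?thesis using subspace_0[OF W] by (intro bexI[of _ 0]) (auto simp: K.zero)
    next
      case False
      define s where "s = r / (2 * norm u)"
      have s: "0 < s" using False r by (simp add: s_def)
      have su: "norm (s *\<^sub>R u) = r / 2" using False r by (simp add: s_def)
      have "z0 + s *\<^sub>R u \<in> ?Z" by (intro subspace_add[OF subZ] subspace_scale[OF subZ] z0 u)
      moreover have "z0 + s *\<^sub>R u \<in> ball z0 r" using su r by (simp add: dist_norm)
      ultimately obtain w1 where w1: "w1 \<in> W" "norm w1 \<le> n" "norm (z0 + s *\<^sub>R u - K w1) < r / 8"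
        using near by blast
      obtain w2 where w2: "w2 \<in> W" "norm w2 \<le> n" "norm (z0 - K w2) < r / 8"
        using near[of z0] z0 r by auto
      define w where "w = (1 / s) *\<^sub>R (w1 - w2)"
      have "w \<in> W" unfolding w_def by (intro subspace_scale[OF W] subspace_diff[OF W] w1 w2)
      moreover have "norm w \<le> 4 * real n / r * norm u"
      proof -
        have "norm w = norm (w1 - w2) / s" using s by (simp add: w_def)
        also have "\<dots> \<le> (2 * n) / s"
          using norm_triangle_ineq4[of w1 w2] w1 w2 s by (intro divide_right_mono) auto
        also have "\<dots> = 4 * real n / r * norm u" by (simp add: s_def)
        finally show ?thesis .
      qed
      moreover have "norm (u - K w) \<le> norm u / 2"
      proof -
        have "u - K w = (1 / s) *\<^sub>R ((z0 + s *\<^sub>R u - K w1) - (z0 - K w2))"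
          using s by (simp add: w_def K.scale K.diff algebra_simps)
        then have "norm (u - K w) = norm ((z0 + s *\<^sub>R u - K w1) - (z0 - K w2)) / s"
          using s by (simp add: divide_inverse_commute)
        also have "\<dots> \<le> (r / 4) / s"
          using norm_triangle_ineq4[of "z0 + s *\<^sub>R u - K w1" "z0 - K w2"] w1 w2 s
          by (intro divide_right_mono) auto
        also have "\<dots> = norm u / 2" using r False by (simp add: s_def)
        finally show ?thesis .
      qed
      ultimately show ?thesis by blast
    qed
  qed
qed

text \<open>Second half: the residual is halved at each step, so the corrections are dominated by a
  geometric series, which costs the factor 2. Their sum stays in the closed
  \<open>W\<close>.\<close>

theorem closed_image_bounded_preimage:
  fixes K :: "'e::banach \<Rightarrow> 'y::banach"
  assumes K: "bounded_linear K" and W: "subspace W" "closed W" and cl: "closed (K ` W)"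
  obtains C where "0 \<le> C" "\<And>u. u \<in> K ` W \<Longrightarrow> \<exists>w\<in>W. K w = u \<and> norm w \<le> C * norm u"
proof -
  interpret K: bounded_linear K by fact
  let ?Z = "K ` W"
  have subZ: "subspace ?Z" by (rule linear_subspace_image[OF K.linear W(1)])
  obtain C where C: "0 \<le> C"
    "\<And>u. u \<in> ?Z \<Longrightarrow> \<exists>w\<in>W. norm w \<le> C * norm u \<and> norm (u - K w) \<le> norm u / 2"
    using linear_image_approx_preimage[OF K.linear W(1) cl] by blast
  then obtain g where g: "\<And>u. u \<in> ?Z \<Longrightarrow> g u \<in> W" "\<And>u. u \<in> ?Z \<Longrightarrow> norm (g u) \<le> C * norm u"
    "\<And>u. u \<in> ?Z \<Longrightarrow> norm (u - K (g u)) \<le> norm u / 2"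
    by metis
  show thesis
  proof (rule that)
    show "0 \<le> 2 * C" using C by simp
    fix u assume u: "u \<in> ?Z"
    \<comment> \<open>\<open>v n\<close> is the residual after \<open>n\<close> corrections; the
      images of the partial sums of corrections telescope to \<open>u - v n\<close>.\<close>
    define v where "v n = ((\<lambda>z. z - K (g z)) ^^ n) u" for n
    have v0: "v 0 = u" and vS: "v (Suc n) = v n - K (g (v n))" for n by (simp_all add: v_def)
    have vZ: "v n \<in> ?Z" for n
      by (induction n) (auto simp: v0 vS u intro!: subspace_diff[OF subZ] g(1))
    have vn: "norm (v n) \<le> norm u * (1/2) ^ n" for n
    proof (induction n)
      case (Suc n)
      show ?case using g(3)[OF vZ[of n]] Suc by (simp add: vS)
    qed (simp add: v0)
    define a where "a n = g (v n)" for n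
    have an: "norm (a n) \<le> C * norm u * (1/2) ^ n" for n
      using g(2)[OF vZ[of n]] mult_left_mono[OF vn[of n] C(1)] by (simp add: a_def mult.assoc)
    have geo: "(\<lambda>n. C * norm u * (1/2) ^ n) sums (C * norm u * 2)"
      using sums_mult[OF geometric_sums[of "1/2::real"], of "C * norm u"] by simp
    have sn: "summable (\<lambda>n. norm (a n))"
      by (rule summable_comparison_test'[OF sums_summable[OF geo], of 0]) (use an in auto)
    then have sa: "summable a" by (rule summable_norm_cancel)
    have "norm (suminf a) \<le> (\<Sum>n. norm (a n))" by (rule summable_norm[OF sn])
    also have "\<dots> \<le> C * norm u * 2"
      using suminf_le[OF an sn sums_summable[OF geo]] sums_unique[OF geo] by simp
    finally have 1: "norm (suminf a) \<le> 2 * C * norm u" by simp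
    have part: "sum a {..<n} \<in> W" for n
      by (rule subspace_sum[OF W(1)]) (auto simp: a_def intro: g(1) vZ)
    have lim: "(\<lambda>n. sum a {..<n}) \<longlonglongrightarrow> suminf a" by (rule summable_LIMSEQ[OF sa])
    have 2: "suminf a \<in> W" by (rule closed_sequentially[OF W(2) part lim])
    have "K (sum a {..<n}) = u - v n" for n
      by (induction n) (auto simp: v0 vS a_def K.add K.zero)
    then have "(\<lambda>n. u - v n) \<longlonglongrightarrow> K (suminf a)"
      using K.tendsto[OF lim] by simp
    moreover have "v \<longlonglongrightarrow> 0"
    proof (rule Lim_null_comparison)
      show "\<forall>\<^sub>F n in sequentially. norm (v n) \<le> norm u * (1/2) ^ n" using vn by simp
      show "(\<lambda>n. norm u * (1/2) ^ n) \<longlonglongrightarrow> 0"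
        by (intro tendsto_mult_right_zero LIMSEQ_power_zero) simp
    qed
    then have "(\<lambda>n. u - v n) \<longlonglongrightarrow> u - 0" by (intro tendsto_diff tendsto_const)
    ultimately have "K (suminf a) = u" using LIMSEQ_unique by fastforce
    with 1 2 show "\<exists>w\<in>W. K w = u \<and> norm w \<le> 2 * C * norm u" by blast
  qed
qed

subsection \<open>Lagrange multipliers\<close>

text \<open>The multiplier is any linear functional below the sublinear functional
  \<open>y \<mapsto> inf {r k(w) + D \<parallel>y - r K w\<parallel> | r > 0, w \<in> W}\<close>, the term with \<open>D\<close> extending the
  directional value function from \<open>K W\<close> to the whole space.\<close>

lemma convex_multiplier_subspace:
  fixes K :: "'e::banach \<Rightarrow>\<^sub>L 'y::banach"
  assumes W: "subspace W" "closed W" and cl: "closed (blinfun_apply K ` W)"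
    and k: "convex_on W k"
    and \<delta>: "0 < \<delta>" and bound: "\<And>w. w \<in> W \<Longrightarrow> norm w \<le> \<delta> \<Longrightarrow> k w \<le> c"
    and ker: "\<And>w. w \<in> W \<Longrightarrow> K w = 0 \<Longrightarrow> 0 \<le> k w"
  shows "\<exists>g :: 'y \<Rightarrow>\<^sub>L real. \<forall>w\<in>W. g (K w) \<le> k w"
proof -
  obtain C where C: "0 \<le> C" "\<And>u. u \<in> K ` W \<Longrightarrow> \<exists>w\<in>W. K w = u \<and> norm w \<le> C * norm u"
    using closed_image_bounded_preimage[OF blinfun.bounded_linear_right W cl] by blast
  have W0: "0 \<in> W" by (rule subspace_0[OF W(1)])
  have k0: "0 \<le> k 0" using ker[OF W0] by simp
  have c: "0 \<le> c" using bound[OF W0] k0 \<delta> by simp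
  \<comment> \<open>\<open>D\<close> is the slope in the lower bound \<open>low\<close>;
    \<open>C + 1\<close> instead of \<open>C\<close> avoids a division by zero there.\<close>
  define D where "D = c * (C + 1) / \<delta>"
  have D: "0 \<le> D" using c C \<delta> by (simp add: D_def)
  \<comment> \<open>Convexity in homogeneous form: \<open>r * k w\<close> is subadditive in the pair
    of \<open>r\<close> and \<open>r *\<^sub>R w\<close>.\<close>
  have comb: "(r + s) * k ((1 / (r + s)) *\<^sub>R (r *\<^sub>R w + s *\<^sub>R v)) \<le> r * k w + s * k v"
    if "w \<in> W" "v \<in> W" "0 < r" "0 < s" for w v r s
  proof -
    have "k ((r / (r + s)) *\<^sub>R w + (s / (r + s)) *\<^sub>R v) \<le> r / (r + s) * k w + s / (r + s) * k v"
      by (rule k[unfolded convex_on_def, THEN conjunct2, rule_format])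
        (use that in \<open>auto simp: add_divide_distrib[symmetric]\<close>)
    then have "(r + s) * k ((r / (r + s)) *\<^sub>R w + (s / (r + s)) *\<^sub>R v)
        \<le> (r + s) * (r / (r + s) * k w + s / (r + s) * k v)"
      using that by (intro mult_left_mono) auto
    also have "r / (r + s) * k w + s / (r + s) * k v = (r * k w + s * k v) / (r + s)"
      by (simp add: add_divide_distrib)
    also have "(r + s) * \<dots> = r * k w + s * k v" using that by simp
    finally show ?thesis by (simp add: scaleR_add_right)
  qed
  \<comment> \<open>A preimage \<open>w'\<close> of \<open>- K w\<close>, scaled to norm at most
    \<open>\<delta>\<close>, is averaged with \<open>w\<close> into the kernel of \<open>K\<close>,
    where \<open>k\<close> is nonnegative. Since \<open>k\<close> is at most \<open>c\<close> at the
    scaled point, \<open>k w\<close> cannot be too negative.\<close>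
  have low: "- D * norm (K w) \<le> k w" if w: "w \<in> W" for w
  proof (cases "K w = 0")
    case True
    then show ?thesis using ker[OF w] by simp
  next
    case False
    have "- K w \<in> K ` W"
      using w subspace_neg[OF W(1) w] by (metis blinfun.minus_right image_eqI)
    then obtain w' where w': "w' \<in> W" "K w' = - K w" "norm w' \<le> C * norm (K w)"
      using C(2)[of "- K w"] by auto
    define s where "s = \<delta> / ((C + 1) * norm (K w))"
    have s: "0 < s" using False \<delta> C by (simp add: s_def)
    have "norm w' \<le> (C + 1) * norm (K w)"
      using w'(3) by (rule order_trans) (simp add: mult_right_mono)
    then have "s * norm w' \<le> s * ((C + 1) * norm (K w))"
      using s by (intro mult_left_mono) auto
    also have "\<dots> = \<delta>" using False C by (simp add: s_def)
    finally have "norm (s *\<^sub>R w') \<le> \<delta>" using s by simp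
    then have "k (s *\<^sub>R w') \<le> c" by (intro bound subspace_scale[OF W(1)] w')
    moreover have "0 \<le> s * k w + 1 * k (s *\<^sub>R w')"
    proof -
      have "0 \<le> k ((1 / (s + 1)) *\<^sub>R (s *\<^sub>R w + 1 *\<^sub>R (s *\<^sub>R w')))"
        using w'(2)
        by (intro ker subspace_scale[OF W(1)] subspace_add[OF W(1)] w w')
          (simp add: blinfun.add_right blinfun.scaleR_right)
      then have "0 \<le> (s + 1) * k ((1 / (s + 1)) *\<^sub>R (s *\<^sub>R w + 1 *\<^sub>R (s *\<^sub>R w')))"
        using s by (intro mult_nonneg_nonneg) auto
      also have "\<dots> \<le> s * k w + 1 * k (s *\<^sub>R w')"
        using s by (intro comb subspace_scale[OF W(1)] w w') auto
      finally show ?thesis .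
    qed
    ultimately have "- c \<le> s * k w" by simp
    then have "- (c / s) \<le> k w" using s by (simp add: field_simps)
    then show ?thesis by (simp add: s_def D_def mult.assoc)
  qed
  define S where "S y = (\<lambda>(r, w). r * k w + D * norm (y - r *\<^sub>R K w)) ` ({0<..} \<times> W)" for y
  define p where "p y = Inf (S y)" for y
  have lowS: "- D * norm y \<le> r * k w + D * norm (y - r *\<^sub>R K w)"
    if "0 < r" "w \<in> W" for y r w
  proof -
    have "r * (- D * norm (K w)) \<le> r * k w"
      using low[OF that(2)] that(1) by (intro mult_left_mono) auto
    moreover have "norm (r *\<^sub>R K w) \<le> norm y + norm (y - r *\<^sub>R K w)"
      using norm_triangle_ineq4[of y "y - r *\<^sub>R K w"] by simp
    then have "D * norm (r *\<^sub>R K w) \<le> D * (norm y + norm (y - r *\<^sub>R K w))"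
      using D by (rule mult_left_mono)
    ultimately show ?thesis using that(1) by (simp add: algebra_simps)
  qed
  have bdd: "bdd_below (S y)" for y
    unfolding S_def using lowS by (intro bdd_belowI2[where m = "- D * norm y"]) auto
  have ne: "S y \<noteq> {}" for y using W0 by (auto simp: S_def intro: gt_ex)
  have ple: "p y \<le> r * k w + D * norm (y - r *\<^sub>R K w)" if "0 < r" "w \<in> W" for y r w
    unfolding p_def by (rule cInf_lower[OF _ bdd]) (use that in \<open>force simp: S_def\<close>)
  have pge: "b \<le> p y" if "\<And>r w. 0 < r \<Longrightarrow> w \<in> W \<Longrightarrow> b \<le> r * k w + D * norm (y - r *\<^sub>R K w)" for b y
    unfolding p_def by (rule cInf_greatest[OF ne]) (use that in \<open>auto simp: S_def\<close>)
  have "sublinear p"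
    unfolding sublinear_def
  proof (intro conjI allI impI)
    fix x y
    have 1: "p (x + y) \<le> (r * k w + D * norm (x - r *\<^sub>R K w)) + (s * k v + D * norm (y - s *\<^sub>R K v))"
      if rs: "0 < r" "w \<in> W" "0 < s" "v \<in> W" for r w s v
    proof -
      let ?z = "(1 / (r + s)) *\<^sub>R (r *\<^sub>R w + s *\<^sub>R v)"
      have z: "?z \<in> W" by (intro subspace_scale[OF W(1)] subspace_add[OF W(1)] rs)
      have "p (x + y) \<le> (r + s) * k ?z + D * norm (x + y - (r + s) *\<^sub>R K ?z)"
        using rs by (intro ple z) auto
      also have "(r + s) *\<^sub>R K ?z = r *\<^sub>R K w + s *\<^sub>R K v"
        using rs by (simp add: blinfun.add_right blinfun.scaleR_right)
      also have "x + y - (r *\<^sub>R K w + s *\<^sub>R K v) = (x - r *\<^sub>R K w) + (y - s *\<^sub>R K v)" by simp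
      also have "(r + s) * k ?z + D * norm ((x - r *\<^sub>R K w) + (y - s *\<^sub>R K v))
          \<le> (r * k w + s * k v) + D * (norm (x - r *\<^sub>R K w) + norm (y - s *\<^sub>R K v))"
        by (intro add_mono comb rs mult_left_mono norm_triangle_ineq D)
      finally show ?thesis by (simp add: algebra_simps)
    qed
    have "p (x + y) - (r * k w + D * norm (x - r *\<^sub>R K w)) \<le> p y" if "0 < r" "w \<in> W" for r w
      using 1[OF that] by (intro pge) (smt (verit))
    then have "p (x + y) - p y \<le> p x" by (intro pge) (smt (verit))
    then show "p (x + y) \<le> p x + p y" by simp
  next
    fix t :: real and x assume t: "0 < t"
    have "p (t *\<^sub>R x) / t \<le> r * k w + D * norm (x - r *\<^sub>R K w)" if "0 < r" "w \<in> W" for r w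
    proof -
      have "p (t *\<^sub>R x) \<le> (t * r) * k w + D * norm (t *\<^sub>R x - (t * r) *\<^sub>R K w)"
        using that t by (intro ple) auto
      also have "t *\<^sub>R x - (t * r) *\<^sub>R K w = t *\<^sub>R (x - r *\<^sub>R K w)" by (simp add: algebra_simps)
      also have "norm \<dots> = t * norm (x - r *\<^sub>R K w)" using t by simp
      finally show ?thesis using t by (simp add: field_simps)
    qed
    then have "p (t *\<^sub>R x) / t \<le> p x" by (rule pge)
    then show "p (t *\<^sub>R x) \<le> t * p x" using t by (simp add: field_simps)
  qed
  then obtain g where g: "linear g" "\<And>y. g y \<le> p y" by (rule hahn_banach_sublinear) blast
  interpret g: linear g by fact
  \<comment> \<open>The point \<open>w = 0\<close> with \<open>r\<close> tending to 0 removes the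
    contribution of \<open>k 0\<close>.\<close>
  have gle: "g y \<le> D * norm y" for y
  proof (rule field_le_epsilon)
    fix e :: real assume e: "0 < e"
    define r where "r = e / (k 0 + 1)"
    have r: "0 < r" "r * k 0 \<le> e" using e k0 by (auto simp: r_def field_simps)
    show "g y \<le> D * norm y + e" using g(2)[of y] ple[OF r(1) W0, of y] r(2) by simp
  qed
  have "bounded_linear g"
  proof (rule bounded_linear_intro)
    show "norm (g y) \<le> norm y * D" for y
      using gle[of y] gle[of "- y"] by (simp add: g.neg abs_le_iff mult.commute)
  qed (simp_all add: g.add g.scale)
  then have "blinfun_apply (Blinfun g) = g" by (rule bounded_linear_Blinfun_apply)
  \<comment> \<open>With \<open>r = 1\<close> and \<open>y = K w\<close> the norm term
    vanishes.\<close>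
  moreover have "g (K w) \<le> k w" if "w \<in> W" for w
    using g(2)[of "K w"] ple[of 1 w "K w"] that by simp
  ultimately show ?thesis by (intro exI[of _ "Blinfun g"]) simp
qed

text \<open>Translating a feasible point \<open>w0\<close> to the origin turns \<open>W\<close> into
  a subspace, and continuity at \<open>w0\<close> bounds \<open>k\<close> near it.\<close>

theorem convex_multiplier:
  fixes K :: "'e::banach \<Rightarrow>\<^sub>L 'y::banach"
  assumes W: "affine W" "closed W" and cl: "closed (blinfun_apply K ` W)"
    and feasible: "0 \<in> blinfun_apply K ` W"
    and k: "convex_on W k" "continuous_on W k"
    and ker: "\<And>w. w \<in> W \<Longrightarrow> K w = 0 \<Longrightarrow> 0 \<le> k w"
  shows "\<exists>g :: 'y \<Rightarrow>\<^sub>L real. \<forall>w\<in>W. g (K w) \<le> k w"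
proof -
  obtain w0 where w0: "w0 \<in> W" "K w0 = 0" using feasible by auto
  obtain \<delta> where \<delta>: "0 < \<delta>" "\<And>w. w \<in> W \<Longrightarrow> dist w w0 < \<delta> \<Longrightarrow> dist (k w) (k w0) < 1"
    using k(2) w0(1) unfolding continuous_on_iff by (meson zero_less_one)
  let ?V = "(\<lambda>x. x - w0) ` W"
  have V: "x \<in> ?V \<longleftrightarrow> w0 + x \<in> W" for x by (force simp: image_iff)
  have KV: "blinfun_apply K ` ?V = blinfun_apply K ` W"
    using w0(2) by (auto simp: image_image blinfun.diff_right)
  have "\<exists>g :: 'y \<Rightarrow>\<^sub>L real. \<forall>v\<in>?V. g (K v) \<le> k (w0 + v)"
  proof (rule convex_multiplier_subspace[of ?V K "\<lambda>v. k (w0 + v)" "\<delta> / 2" "k w0 + 1"])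
    show "subspace ?V" by (rule affine_diffs_subspace_subtract[OF W(1) w0(1)])
    show "closed ?V" using W(2) by (rule closed_translation_subtract)
    show "closed (blinfun_apply K ` ?V)" using cl by (simp only: KV)
    show "convex_on ?V (\<lambda>v. k (w0 + v))"
      unfolding convex_on_def
    proof (intro conjI ballI allI impI)
      show "convex ?V"
        by (intro subspace_imp_convex affine_diffs_subspace_subtract W(1) w0(1))
      fix x y and u v :: real assume *: "x \<in> ?V" "y \<in> ?V" "0 \<le> u" "0 \<le> v" "u + v = 1"
      have "w0 + (u *\<^sub>R x + v *\<^sub>R y) = (u + v) *\<^sub>R w0 + (u *\<^sub>R x + v *\<^sub>R y)" using * by simp
      also have "\<dots> = u *\<^sub>R (w0 + x) + v *\<^sub>R (w0 + y)" by (simp only: scaleR_add_left scaleR_add_right ac_simps)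
      finally show "k (w0 + (u *\<^sub>R x + v *\<^sub>R y)) \<le> u * k (w0 + x) + v * k (w0 + y)"
        using k(1) * unfolding convex_on_def V by simp
    qed
    show "0 < \<delta> / 2" using \<delta> by simp
    show "k (w0 + w) \<le> k w0 + 1" if "w \<in> ?V" "norm w \<le> \<delta> / 2" for w
      using \<delta>(2)[of "w0 + w"] that \<delta>(1) by (simp add: V dist_norm)
    show "0 \<le> k (w0 + w)" if "w \<in> ?V" "K w = 0" for w
      using ker[of "w0 + w"] that w0(2) by (simp add: V blinfun.add_right)
  qed
  then obtain g :: "'y \<Rightarrow>\<^sub>L real" where g: "\<And>v. v \<in> ?V \<Longrightarrow> g (K v) \<le> k (w0 + v)" by blast
  show ?thesis
  proof (intro exI[of _ g] ballI)
    fix w assume "w \<in> W"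
    then show "g (K w) \<le> k w" using g[of "w - w0"] w0(2) by (simp add: blinfun.diff_right)
  qed
qed

subsection \<open>Monotone operators with convex graph\<close>

lemma monotone_opD:
  "monotone_op A \<Longrightarrow> f \<in> A x \<Longrightarrow> g \<in> A y \<Longrightarrow> 0 \<le> blinfun_apply (f - g) (x - y)"
  by (auto simp: monotone_op_def monotone_set_def op_graph_def)

text \<open>Adding a monotonically related point keeps the graph monotone, so by maximality it was
  there already.\<close>

lemma maximal_monotone_op_memI:
  assumes A: "maximal_monotone_op A"
    and rel: "\<And>a f. f \<in> A a \<Longrightarrow> 0 \<le> blinfun_apply (y - f) (x - a)"
  shows "y \<in> A x"
proof -
  have "blinfun_apply (f - y) (a - x) = blinfun_apply (y - f) (x - a)" for a f
    by (simp add: blinfun.diff_left blinfun.diff_right)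
  with A rel have "monotone_set (insert (x, y) (op_graph A))"
    by (auto simp: maximal_monotone_op_def monotone_op_def monotone_set_def op_graph_def)
  then have "insert (x, y) (op_graph A) = op_graph A"
    using A unfolding maximal_monotone_op_def by blast
  then show ?thesis by (auto simp: op_graph_def)
qed

lemma maximal_monotone_opI:
  assumes mono: "monotone_op A"
    and max: "\<And>x y. (\<And>a f. f \<in> A a \<Longrightarrow> 0 \<le> blinfun_apply (y - f) (x - a)) \<Longrightarrow> y \<in> A x"
  shows "maximal_monotone_op A"
  unfolding maximal_monotone_op_def
proof (intro conjI allI impI mono)
  fix G assume G: "monotone_set G \<and> op_graph A \<subseteq> G"
  have "y \<in> A x" if "(x, y) \<in> G" for x y
  proof (rule max)
    fix a f assume "f \<in> A a"
    then have "(a, f) \<in> G" using G by (auto simp: op_graph_def)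
    then show "0 \<le> blinfun_apply (y - f) (x - a)"
      using G that by (auto simp: monotone_set_def)
  qed
  then show "G = op_graph A" using G by (auto simp: op_graph_def)
qed

text \<open>By maximality the graph is the intersection, over its own points, of the sets of pairs
  related to each; these are closed because the pairing is norm continuous.\<close>

lemma closed_op_graph:
  assumes A: "maximal_monotone_op A"
  shows "closed (op_graph A)"
proof -
  have "op_graph A =
      (\<Inter>(a, f)\<in>op_graph A. {p. 0 \<le> blinfun_apply (snd p - f) (fst p - a)})"
  proof
    show "op_graph A \<subseteq> (\<Inter>(a, f)\<in>op_graph A. {p. 0 \<le> blinfun_apply (snd p - f) (fst p - a)})"
      using A by (auto simp: op_graph_def maximal_monotone_op_def intro: monotone_opD)
    show "(\<Inter>(a, f)\<in>op_graph A. {p. 0 \<le> blinfun_apply (snd p - f) (fst p - a)}) \<subseteq> op_graph A"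
      by (auto simp: op_graph_def intro!: maximal_monotone_op_memI[OF A])
  qed
  moreover have "closed {p::'a \<times> ('a \<Rightarrow>\<^sub>L real). 0 \<le> blinfun_apply (snd p - f) (fst p - a)}" for a f
    by (intro closed_Collect_le continuous_intros)
  ultimately show ?thesis by (metis (no_types, lifting) closed_INT case_prod_beta)
qed

text \<open>For \<open>u \<ge> 1\<close>, the difference of \<open>u p - (u - 1) q\<close> and a point of the convex graph is \<open>u\<close> times
  a difference of two points of the graph, so \<open>u p - (u - 1) q\<close> is monotonically related to it.\<close>

lemma affine_op_graph:
  assumes A: "maximal_monotone_op A" and conv: "convex (op_graph A)"
  shows "affine (op_graph A)"
proof -
  have ext: "(1 - u) *\<^sub>R q + u *\<^sub>R p \<in> op_graph A"
    if p: "p \<in> op_graph A" and q: "q \<in> op_graph A" and u: "1 \<le> u" for p q and u :: real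
  proof -
    let ?r = "(1 - u) *\<^sub>R q + u *\<^sub>R p"
    have "snd ?r \<in> A (fst ?r)"
    proof (rule maximal_monotone_op_memI[OF A])
      fix a f assume "f \<in> A a"
      then have z: "(a, f) \<in> op_graph A" by (simp add: op_graph_def)
      \<comment> \<open>Chosen so that \<open>?r - (a, f) = u *\<^sub>R (p - c)\<close>; since
        \<open>1 \<le> u\<close>, this is a convex combination.\<close>
      define c where "c = (1 - 1 / u) *\<^sub>R q + (1 / u) *\<^sub>R (a, f)"
      have "c \<in> op_graph A" unfolding c_def using u by (intro convexD[OF conv q z]) auto
      then have "0 \<le> blinfun_apply (snd p - snd c) (fst p - fst c)"
        using A p by (intro monotone_opD[of A]) (auto simp: maximal_monotone_op_def op_graph_def)
      moreover have "?r - (a, f) = u *\<^sub>R (p - c)"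
        using u by (simp add: c_def algebra_simps)
      then have "fst ?r - a = u *\<^sub>R (fst p - fst c)" "snd ?r - f = u *\<^sub>R (snd p - snd c)"
        by (metis fst_conv fst_diff fst_scaleR, metis snd_conv snd_diff snd_scaleR)
      ultimately show "0 \<le> blinfun_apply (snd ?r - f) (fst ?r - a)"
        using u by (simp add: blinfun.scaleR_left blinfun.scaleR_right)
    qed
    then show ?thesis by (simp add: op_graph_def case_prod_unfold)
  qed
  show ?thesis
    unfolding affine_alt
  proof (intro ballI allI)
    fix p q and u :: real assume pq: "p \<in> op_graph A" "q \<in> op_graph A"
    consider "1 \<le> u" | "u \<le> 0" | "0 \<le> u" "u \<le> 1" by linarith
    then show "(1 - u) *\<^sub>R p + u *\<^sub>R q \<in> op_graph A"
    proof cases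
      case 1
      then show ?thesis using ext pq by blast
    next
      case 2
      then show ?thesis using ext[OF pq, of "1 - u"] by (simp add: add.commute)
    next
      case 3
      then show ?thesis using pq convexD[OF conv, of p q "1 - u" u] by auto
    qed
  qed
qed

text \<open>If one of the two memberships failed, some term of one kind would be negative, which forces
  the other membership; evaluating there gives a contradiction.\<close>

lemma maximal_monotone_op_pair_memI:
  assumes A: "maximal_monotone_op A" and M: "maximal_monotone_op M"
    and rel: "\<And>a f b h. f \<in> A a \<Longrightarrow> h \<in> M b \<Longrightarrow>
      0 \<le> blinfun_apply (y - f) (x - a) + blinfun_apply (w - h) (z - b)"
  shows "y \<in> A x \<and> w \<in> M z"
proof (rule ccontr)
  assume *: "\<not> ?thesis"
  have "y \<in> A x"
  proof (rule ccontr)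
    assume "y \<notin> A x"
    then obtain a f where af: "f \<in> A a" "blinfun_apply (y - f) (x - a) < 0"
      using maximal_monotone_op_memI[OF A, of y x] by (meson not_le)
    have "w \<in> M z"
      by (rule maximal_monotone_op_memI[OF M]) (use rel[OF af(1)] af(2) in \<open>smt (verit)\<close>)
    then show False using rel[OF af(1), of w z] af(2) by simp
  qed
  moreover from this have "w \<in> M z"
    using rel[of y x] by (intro maximal_monotone_op_memI[OF M]) simp
  ultimately show False using * by blast
qed

text \<open>The convexity defect of the pairing is exactly \<open>u * v\<close> times the
  monotonicity expression.\<close>

lemma duality_pairing_convex_le:
  assumes mono: "monotone_op A" and A: "f \<in> A a" "g \<in> A b"
    and uv: "0 \<le> u" "0 \<le> v" "u + v = 1"
  shows "blinfun_apply (u *\<^sub>R f + v *\<^sub>R g) (u *\<^sub>R a + v *\<^sub>R b) \<le> u * f a + v * g b"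
proof -
  have v: "v = 1 - u" using uv by simp
  have "0 \<le> u * v * blinfun_apply (f - g) (a - b)"
    using monotone_opD[OF mono A] uv by simp
  also have "\<dots> = u * f a + v * g b - blinfun_apply (u *\<^sub>R f + v *\<^sub>R g) (u *\<^sub>R a + v *\<^sub>R b)"
    by (simp add: v blinfun.bilinear_simps algebra_simps)
  finally show ?thesis by simp
qed

section \<open>Maximality of sums with pullbacks\<close>

lemma op_pullback_memI: "h \<in> M (blinfun_apply L x) \<Longrightarrow> h o\<^sub>L L \<in> op_pullback L M x"
  by (auto simp: op_pullback_def dual_adjoint_def)

lemma monotone_op_sum_pullback:
  assumes A: "monotone_op A" and M: "monotone_op M"
  shows "monotone_op (op_sum A (op_pullback L M))"
  unfolding monotone_op_def monotone_set_def
proof clarsimp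
  fix x y p q
  assume "(x, p) \<in> op_graph (op_sum A (op_pullback L M))"
    and "(y, q) \<in> op_graph (op_sum A (op_pullback L M))"
  then obtain f h f' h' where "f \<in> A x" "h \<in> M (L x)" "p = f + (h o\<^sub>L L)"
    "f' \<in> A y" "h' \<in> M (L y)" "q = f' + (h' o\<^sub>L L)"
    by (auto simp: op_graph_def op_sum_def op_pullback_def dual_adjoint_def)
  then show "0 \<le> blinfun_apply (p - q) (x - y)"
    using monotone_opD[OF A, of f x f' y] monotone_opD[OF M, of h "L x" h' "L y"]
    by (simp add: blinfun.bilinear_simps)
qed

theorem maximal_monotone_sum_pullback:
  fixes L :: "'x::banach \<Rightarrow>\<^sub>L 'y::banach"
  assumes A: "maximal_monotone_op A" "convex (op_graph A)"
    and M: "maximal_monotone_op M" "convex (op_graph M)"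
    and core: "0 \<in> ic_core (algebraic_diff (blinfun_apply L ` op_domain A) (op_domain M))"
  shows "maximal_monotone_op (op_sum A (op_pullback L M))"
proof (rule maximal_monotone_opI)
  have mono: "monotone_op A" "monotone_op M"
    using A M by (auto simp: maximal_monotone_op_def)
  then show "monotone_op (op_sum A (op_pullback L M))" by (rule monotone_op_sum_pullback)
  fix x0 f0
  assume rel: "\<And>a f. f \<in> op_sum A (op_pullback L M) a \<Longrightarrow> 0 \<le> blinfun_apply (f0 - f) (x0 - a)"
  let ?W = "op_graph A \<times> op_graph M"
  \<comment> \<open>The kernel of \<open>K\<close> encodes the constraint
    \<open>L a = b\<close>.\<close>
  define K :: "(('x \<times> ('x \<Rightarrow>\<^sub>L real)) \<times> ('y \<times> ('y \<Rightarrow>\<^sub>L real))) \<Rightarrow>\<^sub>L 'y"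
    where "K = (L o\<^sub>L fst_blinfun o\<^sub>L fst_blinfun) - (fst_blinfun o\<^sub>L snd_blinfun)"
  have K: "blinfun_apply K ((a, f), (b, h)) = L a - b" for a f b h
    by (simp add: K_def blinfun.diff_left)
  have "affine ?W"
    using affine_op_graph[OF A] affine_op_graph[OF M] by (auto simp: affine_def)
  have KW: "blinfun_apply K ` ?W = algebraic_diff (blinfun_apply L ` op_domain A) (op_domain M)"
    by (force simp: K algebraic_diff_def op_domain_def op_graph_def image_iff)
  \<comment> \<open>The image of an affine set is its own affine hull, so \<open>core\<close>
    reduces to closedness and feasibility.\<close>
  have "affine hull (blinfun_apply K ` ?W) = blinfun_apply K ` (affine hull ?W)"
    by (rule affine_hull_linear_image[symmetric]) (rule blinfun.bounded_linear_right)
  then have hull: "affine hull (blinfun_apply K ` ?W) = blinfun_apply K ` ?W"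
    by (simp only: iffD2[OF affine_hull_eq \<open>affine ?W\<close>])
  have cl: "closed (blinfun_apply K ` ?W)" and zero: "0 \<in> blinfun_apply K ` ?W"
    using core unfolding KW[symmetric] ic_core_def hull rel_core_def by (auto split: if_splits)
  \<comment> \<open>This is \<open>(f0 - f) (x0 - a) - h (L x0 - b)\<close>, expanded; its only
    nonlinear terms are \<open>f a\<close> and \<open>h b\<close>, convex along the two
    graphs.\<close>
  define k where "k = (\<lambda>((a, f), (b, h)).
    blinfun_apply f0 x0 - blinfun_apply f x0 + blinfun_apply f a
      - blinfun_apply h (L x0) + blinfun_apply h b - blinfun_apply f0 a)"
  have "\<exists>g :: 'y \<Rightarrow>\<^sub>L real. \<forall>w\<in>?W. g (K w) \<le> k w"
  proof (rule convex_multiplier)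
    show "closed ?W" by (intro closed_Times closed_op_graph A M)
    show "continuous_on ?W k"
      unfolding k_def case_prod_beta by (intro continuous_intros)
    show "convex_on ?W k"
      unfolding convex_on_def
    proof (intro conjI ballI allI impI)
      show "convex ?W" by (intro convex_Times A M)
      fix w w' and u v :: real
      assume W: "w \<in> ?W" "w' \<in> ?W" and uv: "0 \<le> u" "0 \<le> v" "u + v = 1"
      obtain a f b h a' f' b' h' where w: "w = ((a, f), (b, h))" "w' = ((a', f'), (b', h'))"
        by (metis prod.exhaust)
      have v: "v = 1 - u" using uv by simp
      have "blinfun_apply (u *\<^sub>R f + v *\<^sub>R f') (u *\<^sub>R a + v *\<^sub>R a') \<le> u * f a + v * f' a'"
        using W w uv by (intro duality_pairing_convex_le[OF mono(1)]) (auto simp: op_graph_def)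
      moreover have "blinfun_apply (u *\<^sub>R h + v *\<^sub>R h') (u *\<^sub>R b + v *\<^sub>R b') \<le> u * h b + v * h' b'"
        using W w uv by (intro duality_pairing_convex_le[OF mono(2)]) (auto simp: op_graph_def)
      ultimately show "k (u *\<^sub>R w + v *\<^sub>R w') \<le> u * k w + v * k w'"
        by (simp add: w k_def v blinfun.bilinear_simps algebra_simps)
    qed
    show "0 \<le> k w" if "w \<in> ?W" "K w = 0" for w
    proof -
      obtain a f b h where w: "w = ((a, f), (b, h))" by (metis prod.exhaust)
      have b: "b = L a" and f: "f \<in> A a" and h: "h \<in> M (L a)"
        using that by (auto simp: w K op_graph_def)
      have "f + (h o\<^sub>L L) \<in> op_sum A (op_pullback L M) a"
        using f op_pullback_memI[of h M L a] h by (auto simp: op_sum_def)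
      from rel[OF this] show ?thesis
        by (simp add: w k_def b blinfun.bilinear_simps algebra_simps)
    qed
  qed (fact \<open>affine ?W\<close> cl zero)+
  then obtain g :: "'y \<Rightarrow>\<^sub>L real" where g: "\<And>w. w \<in> ?W \<Longrightarrow> g (K w) \<le> k w" by blast
  have "f0 + (g o\<^sub>L L) \<in> A x0 \<and> - g \<in> M (L x0)"
  proof (rule maximal_monotone_op_pair_memI[OF A(1) M(1)])
    fix a f b h assume "f \<in> A a" "h \<in> M b"
    then have "g (K ((a, f), (b, h))) \<le> k ((a, f), (b, h))"
      by (intro g) (auto simp: op_graph_def)
    \<comment> \<open>The right-hand side is \<open>k - g (L a - b)\<close>: the terms
      \<open>g (L x0)\<close> cancel.\<close>
    then show "0 \<le> blinfun_apply (f0 + (g o\<^sub>L L) - f) (x0 - a) + blinfun_apply (- g - h) (L x0 - b)"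
      by (simp add: K k_def blinfun.bilinear_simps algebra_simps)
  qed
  then have "(f0 + (g o\<^sub>L L)) + ((- g) o\<^sub>L L) \<in> op_sum A (op_pullback L M) x0"
    using op_pullback_memI[of "- g" M L x0] unfolding op_sum_def by blast
  moreover have "(f0 + (g o\<^sub>L L)) + ((- g) o\<^sub>L L) = f0"
    by (rule blinfun_eqI) (simp add: blinfun.bilinear_simps)
  ultimately show "f0 \<in> op_sum A (op_pullback L M) x0" by simp
qed

text \<open>Being related to the points \<open>x - z\<close> and \<open>x + z\<close> forces
  \<open>y z\<close> to have both signs, hence to vanish.\<close>

lemma maximal_monotone_zero: "maximal_monotone_op (\<lambda>x::'x::real_normed_vector. {0})"
proof (rule maximal_monotone_opI)
  show "monotone_op (\<lambda>x::'x. {0})"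
    by (auto simp: monotone_op_def monotone_set_def op_graph_def)
  fix x :: 'x and y :: "'x \<Rightarrow>\<^sub>L real"
  assume rel: "\<And>a f. f \<in> {0} \<Longrightarrow> 0 \<le> blinfun_apply (y - f) (x - a)"
  have "y z = 0" for z
    using rel[of 0 "x - z"] rel[of 0 "x + z"] by (simp add: blinfun.minus_right)
  then show "y \<in> {0}" by (simp add: blinfun_eqI)
qed

theorem theorem5p13:
  fixes L :: "'x::banach \<Rightarrow>\<^sub>L 'y::banach"
    and M :: "'y \<Rightarrow> ('y \<Rightarrow>\<^sub>L real) set"
    and A B :: "'x \<Rightarrow> ('x \<Rightarrow>\<^sub>L real) set"
  shows
    "(maximal_monotone_op M \<and> convex (op_graph M)
        \<and> 0 \<in> ic_core (algebraic_diff (range (blinfun_apply L)) (op_domain M))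
      \<longrightarrow> maximal_monotone_op (op_pullback L M))
   \<and> (maximal_monotone_op A \<and> maximal_monotone_op B
        \<and> convex (op_graph A) \<and> convex (op_graph B)
        \<and> 0 \<in> ic_core (algebraic_diff (op_domain A) (op_domain B))
      \<longrightarrow> maximal_monotone_op (op_sum A B))"
proof (intro conjI impI; elim conjE)
  let ?Z = "\<lambda>x::'x. {0 :: 'x \<Rightarrow>\<^sub>L real}"
  assume M: "maximal_monotone_op M" "convex (op_graph M)"
    and core: "0 \<in> ic_core (algebraic_diff (range (blinfun_apply L)) (op_domain M))"
  have "op_graph ?Z = UNIV \<times> {0}" by (auto simp: op_graph_def)
  then have "convex (op_graph ?Z)" by (simp add: convex_Times)
  moreover have "op_domain ?Z = UNIV" by (simp add: op_domain_def)
  ultimately have "maximal_monotone_op (op_sum ?Z (op_pullback L M))"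
    using maximal_monotone_sum_pullback[OF maximal_monotone_zero _ M, of L] core by simp
  moreover have "op_sum ?Z (op_pullback L M) = op_pullback L M"
    by (auto simp: op_sum_def)
  ultimately show "maximal_monotone_op (op_pullback L M)" by simp
next
  assume A: "maximal_monotone_op A" "convex (op_graph A)"
    and B: "maximal_monotone_op B" "convex (op_graph B)"
    and core: "0 \<in> ic_core (algebraic_diff (op_domain A) (op_domain B))"
  have "g o\<^sub>L id_blinfun = g" for g :: "'x \<Rightarrow>\<^sub>L real" by (rule blinfun_eqI) simp
  then have "op_pullback id_blinfun B = B"
    by (auto simp: op_pullback_def dual_adjoint_def)
  then show "maximal_monotone_op (op_sum A B)"
    using maximal_monotone_sum_pullback[OF A B, of id_blinfun] core by simp
qed

end
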